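(* Let $F$ be a smooth vector field on $M$ tangent to $\partial M$, let $W\subset M$ be an open subset, let $z\in W$ with $F(z)=0$, and let $V\subset W$ be a connected $D$-neighbourhood of $z$ such that the pair $(W,V)$ has the proper boundary intersection property. Then $\mathsf{func}(\mathbf{F}_W,V)=\mathcal{U}_V$.
   Context: $M$ is a smooth manifold of dimension $m$, possibly with boundary; its collaring $M'$ is obtained by gluing a collar $\partial M\times[0,1)$ to $M$ along $\partial M\times 0$. A closed subset $V\subset M$ is a $D$-submanifold if there is an $m$-dimensional submanifold $V'\subset M'$, possibly with boundary, with $V=M\cap V'$ and $\partial M$, $\partial V'$ intersecting transversally; $V$ is a $D$-neighbourhood of each point of its interior in $M$. A map $V\to N$ is smooth if it extends to a smooth map from an open neighbourhood of $V$ in $M'$ to the collaring $N'$ of $N$. $\mathbf{F}:\mathsf{dom}(\mathbf{F})\to M$ is the local flow of $F$, defined on the maximal open set $\mathsf{dom}(\mathbf{F})\subset M\times\mathbb{R}$. $\mathbf{F}_W:\mathsf{dom}(\mathbf{F}_W)\to W$, $\mathsf{dom}(\mathbf{F}_W)\subset W\times\mathbb{R}$, is the local flow of the restriction $F|_W$. $\mathsf{func}(\mathbf{F},V)$ (resp. $\mathsf{func}(\mathbf{F}_W,V)$) is the set of $\alpha\in C^\infty(V,\mathbb{R})$ whose graph lies in $\mathsf{dom}(\mathbf{F})$ (resp. in $\mathsf{dom}(\mathbf{F}_W)$). The shift map is $\varphi_V(\alpha)(x)=\mathbf{F}(x,\alpha(x))$ for $\alpha\in\mathsf{func}(\mathbf{F},V)$,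 and $$\mathcal{U}_V=\{\alpha\in\mathsf{func}(\mathbf{F},V) : \varphi_V(\alpha)(V)\subset W\}.$$ For a subset $V\subset W$, the pair $(W,V)$ has the proper boundary intersection property if for any $x\in V$, $a\in\mathbb{R}$ and $T>1$ such that $\mathbf{F}(x,\tau a)\in W$ for $\tau\in[0,1)\cup\{T\}$ but $\mathbf{F}(x,a)\in\mathrm{Fr}(W)=\overline{W}\setminus W$, there exists $\tau'\in(1,T)$ such that $\mathbf{F}(x,\tau' a)\notin\overline{W}$. *)

theory Defs
  imports "HOL-Analysis.Analysis"
begin

section \<open>Smooth maps between subsets of Euclidean spaces\<close>

text \<open>Meant for open \<open>U\<close>. Continuity of all iterated directional derivatives up to order \<open>k\<close>
  is the same as \<open>f\<close> being of class \<open>C\<^sup>k\<close>, as the domain is finite-dimensional.\<close>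

primrec Ck_on :: "nat \<Rightarrow> 'a::euclidean_space set \<Rightarrow> ('a \<Rightarrow> 'b::real_normed_vector) \<Rightarrow> bool" where
  "Ck_on 0 U f \<longleftrightarrow> continuous_on U f"
| "Ck_on (Suc k) U f \<longleftrightarrow>
     (\<forall>x\<in>U. f differentiable (at x)) \<and> (\<forall>v. Ck_on k U (\<lambda>x. frechet_derivative f (at x) v))"

text \<open>On an arbitrary set, a map is smooth if it extends locally to smooth maps on open sets.\<close>

definition smooth_on :: "'a::euclidean_space set \<Rightarrow> ('a \<Rightarrow> 'b::real_normed_vector) \<Rightarrow> bool" where
  "smooth_on S f \<longleftrightarrow>
     (\<forall>x\<in>S. \<exists>U g. open U \<and> x \<in> U \<and> (\<forall>k. Ck_on k U g) \<and> (\<forall>y\<in>U \<inter> S. g y = f y))"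

section \<open>Smooth manifolds with boundary\<close>

text \<open>The choice of the basis vector is immaterial.\<close>

definition hnormal :: "'e::euclidean_space" where
  "hnormal = (SOME b. b \<in> Basis)"

definition halfspace :: "'e::euclidean_space set" where
  "halfspace = {y. 0 \<le> y \<bullet> hnormal}"

text \<open>A chart is a pair of an open set \<open>U\<close> and a map on \<open>U\<close>; the values of the map outside
  \<open>U\<close> are never used.\<close>

type_synonym ('a, 'e) chart = "'a set \<times> ('a \<Rightarrow> 'e)"

definition chart_inv :: "('a, 'e) chart \<Rightarrow> 'e \<Rightarrow> 'a" where
  "chart_inv c = inv_into (fst c) (snd c)"

definition is_chart :: "('a::topological_space, 'e::euclidean_space) chart \<Rightarrow> bool" where
  "is_chart c \<longleftrightarrow> open (fst c) \<and>
     (open (snd c ` fst c) \<or> openin (top_of_set halfspace) (snd c ` fst c)) \<and>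
     homeomorphism (fst c) (snd c ` fst c) (snd c) (chart_inv c)"

definition transition :: "('a, 'e) chart \<Rightarrow> ('a, 'e) chart \<Rightarrow> 'e \<Rightarrow> 'e" where
  "transition c d = snd d \<circ> chart_inv c"

definition compatible :: "('a, 'e::euclidean_space) chart \<Rightarrow> ('a, 'e) chart \<Rightarrow> bool" where
  "compatible c d \<longleftrightarrow> smooth_on (snd c ` (fst c \<inter> fst d)) (transition c d)
                   \<and> smooth_on (snd d ` (fst c \<inter> fst d)) (transition d c)"

text \<open>The manifold is the whole type \<open>'a\<close>, its dimension is \<open>DIM('e)\<close>.\<close>

definition smooth_manifold ::
    "('a::{t2_space, second_countable_topology}, 'e::euclidean_space) chart set \<Rightarrow> bool" where
  "smooth_manifold A \<longleftrightarrow> (\<forall>c\<in>A. is_chart c) \<and> (\<Union>c\<in>A. fst c) = UNIV \<and>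
     (\<forall>c\<in>A. \<forall>d\<in>A. compatible c d)"

definition maximal_atlas ::
    "('a::topological_space, 'e::euclidean_space) chart set \<Rightarrow> ('a, 'e) chart set" where
  "maximal_atlas A = {c. is_chart c \<and> (\<forall>d\<in>A. compatible c d)}"

text \<open>The interior is taken in the whole space \<open>'e\<close>: a point is a boundary point iff some
  half-space chart sends it to the bounding hyperplane.\<close>

definition manifold_boundary :: "('a, 'e::euclidean_space) chart set \<Rightarrow> 'a set" where
  "manifold_boundary A = {x. \<exists>c\<in>A. x \<in> fst c \<and> snd c x \<notin> interior (snd c ` fst c)}"

section \<open>Tangent vectors, vector fields and local flows\<close>

text \<open>A tangent vector at \<open>x\<close> is given by its coordinates in the charts around \<open>x\<close>, which
  are related by the derivatives of the transition maps.\<close>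

definition tangent_vector ::
    "('a, 'e::euclidean_space) chart set \<Rightarrow> 'a \<Rightarrow> (('a, 'e) chart \<Rightarrow> 'e) \<Rightarrow> bool" where
  "tangent_vector A x v \<longleftrightarrow>
     (\<forall>c\<in>A. \<forall>d\<in>A. x \<in> fst c \<inter> fst d \<longrightarrow>
        (\<exists>D. (transition c d has_derivative D) (at (snd c x) within snd c ` (fst c \<inter> fst d)) \<and>
             v d = D (v c)))"

type_synonym ('a, 'e) vfield = "'a \<Rightarrow> ('a, 'e) chart \<Rightarrow> 'e"

definition smooth_vector_field ::
    "('a, 'e::euclidean_space) chart set \<Rightarrow> ('a, 'e) vfield \<Rightarrow> bool" where
  "smooth_vector_field A F \<longleftrightarrow> (\<forall>x. tangent_vector A x (F x)) \<and>
     (\<forall>c\<in>A. smooth_on (snd c ` fst c) (\<lambda>y. F (chart_inv c y) c))"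

definition vanishes_at ::
    "('a, 'e::euclidean_space) chart set \<Rightarrow> ('a, 'e) vfield \<Rightarrow> 'a \<Rightarrow> bool" where
  "vanishes_at A F z \<longleftrightarrow> (\<forall>c\<in>A. z \<in> fst c \<longrightarrow> F z c = 0)"

text \<open>The tangent space at \<open>x\<close> of a submanifold \<open>S\<close> without boundary, in the coordinates of
  a chart \<open>c\<close> around \<open>x\<close>: velocities of the smooth curves in \<open>S\<close> through \<open>x\<close>.\<close>

definition tangent_space :: "('a, 'e::euclidean_space) chart \<Rightarrow> 'a set \<Rightarrow> 'a \<Rightarrow> 'e set" where
  "tangent_space c S x = {v. \<exists>\<gamma> \<epsilon>::real. 0 < \<epsilon> \<and> \<gamma> 0 = x \<and> \<gamma> ` {-\<epsilon><..<\<epsilon>} \<subseteq> S \<inter> fst c \<and>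
     smooth_on {-\<epsilon><..<\<epsilon>} (snd c \<circ> \<gamma>) \<and> (snd c \<circ> \<gamma> has_vector_derivative v) (at 0)}"

definition tangent_to_boundary ::
    "('a, 'e::euclidean_space) chart set \<Rightarrow> ('a, 'e) vfield \<Rightarrow> bool" where
  "tangent_to_boundary A F \<longleftrightarrow>
     (\<forall>x\<in>manifold_boundary A. \<forall>c\<in>A. x \<in> fst c \<longrightarrow>
        F x c \<in> tangent_space c (manifold_boundary A) x)"

text \<open>Integral curves, on an open interval \<open>J\<close>, of the restriction of \<open>F\<close> to an open set
  \<open>S\<close>: these are the integral curves of \<open>F\<close> that lie in \<open>S\<close>.\<close>

definition integral_curve ::
    "('a::topological_space, 'e::euclidean_space) chart set \<Rightarrow> ('a, 'e) vfield \<Rightarrow> 'a set \<Rightarrow>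
     real set \<Rightarrow> (real \<Rightarrow> 'a) \<Rightarrow> bool" where
  "integral_curve A F S J \<gamma> \<longleftrightarrow> open J \<and> is_interval J \<and> continuous_on J \<gamma> \<and> \<gamma> ` J \<subseteq> S \<and>
     (\<forall>t\<in>J. \<forall>c\<in>A. \<gamma> t \<in> fst c \<longrightarrow>
        (snd c \<circ> \<gamma> has_vector_derivative F (\<gamma> t) c) (at t))"

text \<open>The domain of the local flow of the restriction of \<open>F\<close> to \<open>S\<close> is the union of
  \<open>{x} \<times> J\<close>, \<open>J\<close> being the maximal interval of existence of the integral curve starting
  at \<open>x\<close>. The flow of \<open>F\<close> itself is the case \<open>S = UNIV\<close>.\<close>

definition flow_dom ::
    "('a::topological_space, 'e::euclidean_space) chart set \<Rightarrow> ('a, 'e) vfield \<Rightarrow> 'a set \<Rightarrow>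
     ('a \<times> real) set" where
  "flow_dom A F S = {(x, t). \<exists>J \<gamma>. integral_curve A F S J \<gamma> \<and> 0 \<in> J \<and> t \<in> J \<and> \<gamma> 0 = x}"

definition flow ::
    "('a::topological_space, 'e::euclidean_space) chart set \<Rightarrow> ('a, 'e) vfield \<Rightarrow> 'a set \<Rightarrow>
     'a \<Rightarrow> real \<Rightarrow> 'a" where
  "flow A F S x t =
     (THE y. \<exists>J \<gamma>. integral_curve A F S J \<gamma> \<and> 0 \<in> J \<and> t \<in> J \<and> \<gamma> 0 = x \<and> \<gamma> t = y)"

section \<open>Collarings\<close>

text \<open>Diffeomorphism of a subset \<open>S\<close> of a manifold onto a subset of another manifold,
  smoothness on subsets being local extendability in charts.\<close>

definition smooth_embedding ::
    "('a::topological_space, 'd::euclidean_space) chart set \<Rightarrow>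
     ('b::topological_space, 'e::euclidean_space) chart set \<Rightarrow> 'a set \<Rightarrow> ('a \<Rightarrow> 'b) \<Rightarrow> bool" where
  "smooth_embedding A B S f \<longleftrightarrow> homeomorphism S (f ` S) f (inv_into S f) \<and>
     (\<forall>c\<in>A. \<forall>d\<in>B.
        smooth_on (snd c ` (fst c \<inter> S \<inter> f -` fst d)) (snd d \<circ> f \<circ> chart_inv c) \<and>
        smooth_on (snd d ` (fst d \<inter> f ` (S \<inter> fst c))) (snd c \<circ> inv_into S f \<circ> chart_inv d))"

text \<open>Product charts on the product of a manifold with the real line.\<close>

definition times_line :: "('a, 'e) chart set \<Rightarrow> ('a \<times> real, 'e \<times> real) chart set" where
  "times_line A = (\<lambda>(U, \<phi>). (U \<times> UNIV, \<lambda>(x, t). (\<phi> x, t))) ` A"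

text \<open>The manifold without boundary \<open>(UNIV :: 'b set, A')\<close> is the result of gluing
  \<open>\<partial>M \<times> [0,1)\<close> to \<open>M = (UNIV :: 'a set, A)\<close> along \<open>\<partial>M \<times> 0\<close>, where \<open>\<iota>\<close> and \<open>\<kappa>\<close> are the
  canonical maps of the two pieces. Both images being closed, they carry together the topology
  of the gluing.\<close>

definition collaring ::
    "('a::{t2_space, second_countable_topology}, 'e::euclidean_space) chart set \<Rightarrow>
     ('b::{t2_space, second_countable_topology}, 'e) chart set \<Rightarrow>
     ('a \<Rightarrow> 'b) \<Rightarrow> ('a \<times> real \<Rightarrow> 'b) \<Rightarrow> bool" where
  "collaring A A' \<iota> \<kappa> \<longleftrightarrow>
     smooth_manifold A' \<and> manifold_boundary A' = {} \<and>
     smooth_embedding A A' UNIV \<iota> \<and> closed (range \<iota>) \<and>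
     smooth_embedding (times_line A) A' (manifold_boundary A \<times> {0..<1}) \<kappa> \<and>
     closed (\<kappa> ` (manifold_boundary A \<times> {0..<1})) \<and>
     range \<iota> \<union> \<kappa> ` (manifold_boundary A \<times> {0..<1}) = UNIV \<and>
     (\<forall>x\<in>manifold_boundary A. \<kappa> (x, 0) = \<iota> x) \<and>
     range \<iota> \<inter> \<kappa> ` (manifold_boundary A \<times> {0<..<1}) = {}"

text \<open>\<open>M\<close> is identified with its image under \<open>\<iota>\<close>. The collaring of the real line is the line
  itself. Functions on \<open>V\<close> are represented by total functions that are \<open>undefined\<close> off \<open>V\<close>.\<close>

definition C_inf ::
    "('b::topological_space, 'e::euclidean_space) chart set \<Rightarrow> ('a \<Rightarrow> 'b) \<Rightarrow> 'a set \<Rightarrow>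
     ('a \<Rightarrow> real) set" where
  "C_inf A' \<iota> V = {\<alpha> \<in> extensional V.
     \<exists>Q g. open Q \<and> \<iota> ` V \<subseteq> Q \<and>
           (\<forall>c\<in>A'. smooth_on (snd c ` (fst c \<inter> Q)) (g \<circ> chart_inv c)) \<and>
           (\<forall>x\<in>V. \<alpha> x = g (\<iota> x))}"

section \<open>D-submanifolds\<close>

text \<open>Submanifolds of full dimension, possibly with boundary, of a manifold without boundary.
  A point of \<open>V'\<close> interior to \<open>V'\<close> has slice charts whose image lies in the open half-space.\<close>

definition slice_chart ::
    "('b::topological_space, 'e::euclidean_space) chart set \<Rightarrow> 'b set \<Rightarrow> ('b, 'e) chart \<Rightarrow> bool"
  where
  "slice_chart A' V' c \<longleftrightarrow> c \<in> maximal_atlas A' \<and> open (snd c ` fst c) \<and>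
     snd c ` (fst c \<inter> V') = snd c ` fst c \<inter> halfspace"

definition full_submanifold ::
    "('b::topological_space, 'e::euclidean_space) chart set \<Rightarrow> 'b set \<Rightarrow> bool" where
  "full_submanifold A' V' \<longleftrightarrow> (\<forall>x\<in>V'. \<exists>c. slice_chart A' V' c \<and> x \<in> fst c)"

definition submanifold_boundary ::
    "('b::topological_space, 'e::euclidean_space) chart set \<Rightarrow> 'b set \<Rightarrow> 'b set" where
  "submanifold_boundary A' V' =
     {x\<in>V'. \<exists>c. slice_chart A' V' c \<and> x \<in> fst c \<and> snd c x \<bullet> hnormal = 0}"

definition transversal ::
    "('b, 'e::euclidean_space) chart set \<Rightarrow> 'b set \<Rightarrow> 'b set \<Rightarrow> bool" where
  "transversal A' S T \<longleftrightarrow>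
     (\<forall>x\<in>S \<inter> T. \<forall>c\<in>A'. x \<in> fst c \<longrightarrow>
        {u + v | u v. u \<in> tangent_space c S x \<and> v \<in> tangent_space c T x} = UNIV)"

definition D_submanifold ::
    "('a::topological_space, 'e::euclidean_space) chart set \<Rightarrow>
     ('b::topological_space, 'e) chart set \<Rightarrow> ('a \<Rightarrow> 'b) \<Rightarrow> 'a set \<Rightarrow> bool" where
  "D_submanifold A A' \<iota> V \<longleftrightarrow> closed V \<and>
     (\<exists>V'. full_submanifold A' V' \<and> V = \<iota> -` V' \<and>
           transversal A' (\<iota> ` manifold_boundary A) (submanifold_boundary A' V'))"

definition D_neighbourhood ::
    "('a::topological_space, 'e::euclidean_space) chart set \<Rightarrow>
     ('b::topological_space, 'e) chart set \<Rightarrow> ('a \<Rightarrow> 'b) \<Rightarrow> 'a set \<Rightarrow> 'a \<Rightarrow> bool" where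
  "D_neighbourhood A A' \<iota> V x \<longleftrightarrow> D_submanifold A A' \<iota> V \<and> x \<in> interior V"

section \<open>Shift maps\<close>

text \<open>\<open>func A F S A' \<iota> V\<close> is \<open>func(\<^bold>F, V)\<close> for \<open>S = UNIV\<close> and \<open>func(\<^bold>F\<^sub>W, V)\<close> for \<open>S = W\<close>.\<close>

definition func ::
    "('a::topological_space, 'e::euclidean_space) chart set \<Rightarrow> ('a, 'e) vfield \<Rightarrow> 'a set \<Rightarrow>
     ('b::topological_space, 'e) chart set \<Rightarrow> ('a \<Rightarrow> 'b) \<Rightarrow> 'a set \<Rightarrow> ('a \<Rightarrow> real) set" where
  "func A F S A' \<iota> V = {\<alpha> \<in> C_inf A' \<iota> V. \<forall>x\<in>V. (x, \<alpha> x) \<in> flow_dom A F S}"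

definition shift_map ::
    "('a::topological_space, 'e::euclidean_space) chart set \<Rightarrow> ('a, 'e) vfield \<Rightarrow>
     ('a \<Rightarrow> real) \<Rightarrow> 'a \<Rightarrow> 'a" where
  "shift_map A F \<alpha> x = flow A F UNIV x (\<alpha> x)"

definition U_set ::
    "('a::topological_space, 'e::euclidean_space) chart set \<Rightarrow> ('a, 'e) vfield \<Rightarrow> 'a set \<Rightarrow>
     ('b::topological_space, 'e) chart set \<Rightarrow> ('a \<Rightarrow> 'b) \<Rightarrow> 'a set \<Rightarrow> ('a \<Rightarrow> real) set" where
  "U_set A F W A' \<iota> V = {\<alpha> \<in> func A F UNIV A' \<iota> V. shift_map A F \<alpha> ` V \<subseteq> W}"

text \<open>Here \<open>closure W - W\<close> is \<open>Fr(W)\<close>, \<open>W\<close> being open.\<close>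

definition proper_boundary_intersection ::
    "('a::topological_space, 'e::euclidean_space) chart set \<Rightarrow> ('a, 'e) vfield \<Rightarrow> 'a set \<Rightarrow>
     'a set \<Rightarrow> bool" where
  "proper_boundary_intersection A F W V \<longleftrightarrow>
     (\<forall>x\<in>V. \<forall>a T. 1 < T \<longrightarrow>
        (\<forall>\<tau>\<in>{0..<1} \<union> {T}. (x, \<tau> * a) \<in> flow_dom A F UNIV \<and> flow A F UNIV x (\<tau> * a) \<in> W) \<longrightarrow>
        (x, a) \<in> flow_dom A F UNIV \<and> flow A F UNIV x a \<in> closure W - W \<longrightarrow>
        (\<exists>\<tau>'\<in>{1<..<T}. (x, \<tau>' * a) \<in> flow_dom A F UNIV \<and>
                         flow A F UNIV x (\<tau>' * a) \<notin> closure W))"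

end

theory Submission
  imports Defs
begin

text \<open>Let \<open>V\<^sub>0\<close> be the set of the \<open>x \<in> V\<close> such that \<open>\<^bold>F(x, \<tau> \<alpha>(x)) \<in> W\<close> for all \<open>\<tau> \<in> [0,1]\<close>.
  It contains \<open>z\<close>, and it is open in \<open>V\<close> by continuity of the flow and compactness of \<open>[0,1]\<close>. If
  \<open>x \<in> V\<close> is outside \<open>V\<^sub>0\<close>, its orbit first leaves \<open>W\<close> at some \<open>\<tau>\<^sub>0 \<alpha>(x)\<close> and is back in \<open>W\<close> at
  \<open>\<alpha>(x)\<close>, so it meets the complement of \<open>closure W\<close> in between, and so do the orbits of the nearby
  points; hence \<open>V\<^sub>0\<close> is also closed, and \<open>V\<^sub>0 = V\<close>.

  As \<open>\<alpha> \<in> func(\<^bold>F, V)\<close>, all the integral curves involved are known to exist, and only their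
  continuous dependence on initial point and speed is needed. It follows from local Lipschitz
  estimates, at boundary points as well.\<close>

section \<open>Smooth maps\<close>

text \<open>Each \<open>?D x b\<close> is continuous in \<open>x\<close>, hence bounded on the
  compact ball, and the operator norm is at most the sum of the norms over the basis. The ball being
  convex, the mean value inequality applies.\<close>

lemma Ck_on_1_lipschitz_on_cball:
  fixes g :: "'a::euclidean_space \<Rightarrow> 'b::real_normed_vector"
  assumes C1: "Ck_on (Suc 0) U g" and sub: "cball q r \<subseteq> U"
  shows "\<exists>L. \<forall>x\<in>cball q r. \<forall>y\<in>cball q r. norm (g x - g y) \<le> L * norm (x - y)"
proof -
  let ?D = "\<lambda>x. frechet_derivative g (at x)"
  have diff: "g differentiable (at x)" if "x \<in> U" for x
    using C1 that by simp
  have "\<exists>B. \<forall>x\<in>cball q r. norm (?D x b) \<le> B" for b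
  proof -
    have "continuous_on U (\<lambda>x. ?D x b)"
      using C1 by simp
    then have "continuous_on (cball q r) (\<lambda>x. ?D x b)"
      using sub by (rule continuous_on_subset)
    then have "bounded ((\<lambda>x. ?D x b) ` cball q r)"
      by (intro compact_imp_bounded compact_continuous_image) auto
    then show ?thesis
      by (auto simp: bounded_iff)
  qed
  then obtain B where B: "\<And>b x. x \<in> cball q r \<Longrightarrow> norm (?D x b) \<le> B b"
    by metis
  let ?L = "\<Sum>b\<in>Basis. B b"
  have on: "onorm (?D x) \<le> ?L" if x: "x \<in> cball q r" for x
  proof -
    have lin: "bounded_linear (?D x)"
      using diff x sub frechet_derivative_works has_derivative_bounded_linear by blast
    have "onorm (?D x) \<le> (\<Sum>b\<in>Basis. norm (?D x b))"
      using onorm_componentwise[OF lin] .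
    also have "\<dots> \<le> ?L"
      by (intro sum_mono B x)
    finally show ?thesis .
  qed
  have der: "(g has_derivative ?D u) (at u within cball q r)" if "u \<in> cball q r" for u
  proof -
    have "g differentiable (at u)"
      using diff sub that by blast
    then have "(g has_derivative ?D u) (at u)"
      by (rule frechet_derivative_works[THEN iffD1])
    then show ?thesis
      by (rule has_derivative_at_withinI)
  qed
  have "norm (g x - g y) \<le> ?L * norm (x - y)" if "x \<in> cball q r" "y \<in> cball q r" for x y
    by (rule differentiable_bound[OF convex_cball der on that])
  then show ?thesis by blast
qed

text \<open>The estimate is made for a local extension on a full ball and then restricted, so
  \<open>S\<close> may be any set, in particular the image of a half-space chart.\<close>

lemma smooth_on_locally_lipschitz:
  fixes f :: "'a::euclidean_space \<Rightarrow> 'b::real_normed_vector"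
  assumes "smooth_on S f" "q \<in> S"
  shows "\<exists>r>0. \<exists>L. \<forall>x\<in>S \<inter> cball q r. \<forall>y\<in>S \<inter> cball q r. norm (f x - f y) \<le> L * norm (x - y)"
proof -
  obtain U g where U: "open U" "q \<in> U" "\<forall>k. Ck_on k U g" "\<forall>y\<in>U \<inter> S. g y = f y"
    using assms unfolding smooth_on_def by blast
  obtain r where r: "r > 0" "cball q r \<subseteq> U"
    using U open_contains_cball by blast
  obtain L where L: "\<forall>x\<in>cball q r. \<forall>y\<in>cball q r. norm (g x - g y) \<le> L * norm (x - y)"
    using Ck_on_1_lipschitz_on_cball U(3) r(2) by blast
  have "norm (f x - f y) \<le> L * norm (x - y)" if "x \<in> S \<inter> cball q r" "y \<in> S \<inter> cball q r" for x y
    using L that U(4) r(2) by (metis IntD1 IntD2 IntI subsetD)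
  with r(1) show ?thesis by blast
qed

lemma smooth_on_imp_continuous_on:
  assumes "smooth_on S f"
  shows "continuous_on S f"
proof -
  have "continuous (at x within S) f" if x: "x \<in> S" for x
  proof -
    obtain U g where U: "open U" "x \<in> U" "\<forall>k. Ck_on k U g" "\<forall>y\<in>U \<inter> S. g y = f y"
      using assms x unfolding smooth_on_def by blast
    have "continuous_on U g"
      using U(3) by (metis Ck_on.simps(1))
    then have "continuous_on (S \<inter> U) f"
      using U(4) continuous_on_subset[of U g "S \<inter> U"]
      by (metis (no_types, lifting) Int_commute continuous_on_cong inf_le1)
    then have "continuous (at x within (S \<inter> U)) f"
      using x U(2) by (auto simp: continuous_on_eq_continuous_within)
    moreover have "at x within S = at x within (S \<inter> U)"
      using U(1,2) by (intro at_within_nhd[of x U]) auto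
    ultimately show ?thesis by simp
  qed
  then show ?thesis by (simp add: continuous_on_eq_continuous_within)
qed

section \<open>Charts\<close>

lemma is_chart_open: "is_chart c \<Longrightarrow> open (fst c)"
  by (simp add: is_chart_def)

lemma is_chart_continuous_on: "is_chart c \<Longrightarrow> continuous_on (fst c) (snd c)"
  by (simp add: is_chart_def homeomorphism_def)

lemma chart_inv_snd: "is_chart c \<Longrightarrow> x \<in> fst c \<Longrightarrow> chart_inv c (snd c x) = x"
  by (simp add: is_chart_def homeomorphism_def)

text \<open>Continuity of the inverse chart. This turns norm estimates in coordinates back into
  statements about open sets of the manifold.\<close>

lemma chart_nbhd_inside:
  assumes c: "is_chart c" and p: "p \<in> fst c" and N: "open N" "p \<in> N"
  shows "\<exists>\<rho>>0. \<forall>x\<in>fst c. norm (snd c x - snd c p) < \<rho> \<longrightarrow> x \<in> N"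
proof -
  have "continuous_on (snd c ` fst c) (chart_inv c)"
    using c by (simp add: is_chart_def homeomorphism_def)
  then obtain T where T: "open T" "T \<inter> snd c ` fst c = chart_inv c -` N \<inter> snd c ` fst c"
    using N(1) unfolding continuous_on_open_invariant by blast
  have "snd c p \<in> T"
  proof -
    have "snd c p \<in> chart_inv c -` N"
      using N(2) chart_inv_snd[OF c p] by simp
    then show ?thesis
      using T(2) p by blast
  qed
  then obtain \<rho> where \<rho>: "\<rho> > 0" "ball (snd c p) \<rho> \<subseteq> T"
    using T(1) open_contains_ball by blast
  have "x \<in> N" if x: "x \<in> fst c" "norm (snd c x - snd c p) < \<rho>" for x
  proof -
    have "snd c x \<in> T"
      using x(2) \<rho>(2) by (auto simp: dist_norm norm_minus_commute)
    then have "snd c x \<in> chart_inv c -` N"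
      using T(2) x(1) by blast
    then show ?thesis
      using chart_inv_snd[OF c x(1)] by simp
  qed
  with \<rho>(1) show ?thesis by blast
qed

lemma chart_ball_open:
  assumes c: "is_chart c"
  shows "open {x\<in>fst c. norm (snd c x - q) < r}"
proof -
  have "continuous_on (fst c) (\<lambda>x. norm (snd c x - q))"
    using is_chart_continuous_on[OF c] by (intro continuous_intros)
  then have "open (fst c \<inter> (\<lambda>x. norm (snd c x - q)) -` {..<r})"
    using is_chart_open[OF c] open_lessThan by (rule continuous_open_preimage)
  also have "fst c \<inter> (\<lambda>x. norm (snd c x - q)) -` {..<r} = {x\<in>fst c. norm (snd c x - q) < r}"
    by auto
  finally show ?thesis .
qed

text \<open>Chart images are locally compact, so a small closed coordinate ball is compact, hence
  closed in the whole Hausdorff manifold and not only in \<open>fst c\<close>. A curve therefore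
  cannot leave the chart domain while its coordinates stay in the ball.\<close>

lemma chart_cball_closed:
  fixes c :: "('a::t2_space, 'e::euclidean_space) chart"
  assumes c: "is_chart c" and p: "p \<in> fst c"
  shows "\<exists>r0>0. \<forall>r\<le>r0. closed {x\<in>fst c. norm (snd c x - snd c p) \<le> r}"
proof -
  let ?I = "snd c ` fst c"
  have "closed (halfspace :: 'e set)"
    unfolding halfspace_def by (intro closed_Collect_le continuous_intros)
  \<comment> \<open>\<open>H\<close> can be the whole space for a chart with open image and the
    half-space otherwise; both cases are then alike.\<close>
  then obtain T H where TH: "open T" "closed (H :: 'e set)" "?I = T \<inter> H"
    using c unfolding is_chart_def openin_open by (metis Int_UNIV_right Int_commute closed_UNIV)
  have "snd c p \<in> T"
    using TH(3) p by auto
  then obtain r0 where r0: "r0 > 0" "cball (snd c p) r0 \<subseteq> T"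
    using TH(1) open_contains_cball by blast
  have "closed {x\<in>fst c. norm (snd c x - snd c p) \<le> r}" if "r \<le> r0" for r
  proof -
    have sub: "H \<inter> cball (snd c p) r \<subseteq> ?I"
      using TH(3) r0(2) that by auto
    have "continuous_on ?I (chart_inv c)"
      using c by (simp add: is_chart_def homeomorphism_def)
    then have "compact (chart_inv c ` (H \<inter> cball (snd c p) r))"
      using sub TH(2) by (intro compact_continuous_image closed_Int_compact)
        (auto intro: continuous_on_subset)
    moreover have "chart_inv c ` (H \<inter> cball (snd c p) r)
        = {x\<in>fst c. norm (snd c x - snd c p) \<le> r}"
    proof (intro equalityI subsetI)
      fix x assume "x \<in> chart_inv c ` (H \<inter> cball (snd c p) r)"
      then obtain y where y: "y \<in> H" "y \<in> cball (snd c p) r" "x = chart_inv c y" by auto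
      then obtain x' where "x' \<in> fst c" "y = snd c x'"
        using sub by blast
      then show "x \<in> {x\<in>fst c. norm (snd c x - snd c p) \<le> r}"
        using y chart_inv_snd[OF c] by (auto simp: dist_norm norm_minus_commute)
    next
      fix x assume x: "x \<in> {x\<in>fst c. norm (snd c x - snd c p) \<le> r}"
      then have "snd c x \<in> H \<inter> cball (snd c p) r"
        using TH(3) by (auto simp: dist_norm norm_minus_commute)
      then show "x \<in> chart_inv c ` (H \<inter> cball (snd c p) r)"
        using x chart_inv_snd[OF c] by (metis (mono_tags, lifting) imageI mem_Collect_eq)
    qed
    ultimately show ?thesis
      by (simp add: compact_imp_closed)
  qed
  with r0(1) show ?thesis by blast
qed

lemma smooth_manifold_chart_at:
  assumes "smooth_manifold A"
  obtains c where "c \<in> A" "is_chart c" "x \<in> fst c"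
  using assms unfolding smooth_manifold_def by (metis UNIV_I UN_iff)

section \<open>Continuous dependence on initial point and speed\<close>

text \<open>For an integral curve \<open>\<gamma>\<close> with \<open>\<gamma>(0) = x\<close>, the curve \<open>\<tau> \<mapsto> \<gamma>(\<tau> a)\<close> on \<open>[0,1]\<close> is of this
  kind. With the time interval fixed, the end time becomes a parameter of the equation.\<close>

definition scaled_curve ::
    "('a::topological_space, 'e::euclidean_space) chart set \<Rightarrow> ('a, 'e) vfield \<Rightarrow> real \<Rightarrow>
     (real \<Rightarrow> 'a) \<Rightarrow> bool" where
  "scaled_curve A F a \<eta> \<longleftrightarrow> continuous_on {0..1} \<eta> \<and>
     (\<forall>u\<in>{0..1}. \<forall>c\<in>A. \<eta> u \<in> fst c \<longrightarrow>
        (snd c \<circ> \<eta> has_vector_derivative a *\<^sub>R F (\<eta> u) c) (at u within {0..1}))"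

lemma integral_curve_scaled_time:
  assumes "integral_curve A F S J \<gamma>" "0 \<in> J" "t \<in> J" "u \<in> {0..1}"
  shows "u * t \<in> J"
proof -
  have "convex J"
    using assms(1) by (simp add: integral_curve_def is_interval_convex)
  from convexD_alt[OF this assms(2,3), of u] show ?thesis
    using assms(4) by simp
qed

lemma integral_curve_imp_scaled_curve:
  assumes \<gamma>: "integral_curve A F S J \<gamma>" and "0 \<in> J" "t \<in> J"
  shows "scaled_curve A F t (\<lambda>u. \<gamma> (u * t))"
proof -
  note J = integral_curve_scaled_time[OF assms]
  have "continuous_on {0..1} (\<lambda>u. \<gamma> (u * t))"
  proof (rule continuous_on_compose2[of J \<gamma> _ "\<lambda>u. u * t"])
    show "continuous_on J \<gamma>"
      using \<gamma> by (simp add: integral_curve_def)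
    show "(\<lambda>u. u * t) ` {0..1} \<subseteq> J"
      using J by blast
  qed (intro continuous_intros)
  moreover have "(snd c \<circ> (\<lambda>u. \<gamma> (u * t)) has_vector_derivative t *\<^sub>R F (\<gamma> (u * t)) c)
      (at u within {0..1})" if u: "u \<in> {0..1}" and c: "c \<in> A" "\<gamma> (u * t) \<in> fst c" for u c
  proof -
    have "(snd c \<circ> \<gamma> has_vector_derivative F (\<gamma> (u * t)) c) (at (u * t))"
      using \<gamma> J[OF u] c unfolding integral_curve_def by blast
    then have "(snd c \<circ> \<gamma> has_vector_derivative F (\<gamma> (u * t)) c)
        (at (u * t) within (\<lambda>u. u * t) ` {0..1})"
      by (rule has_vector_derivative_at_within)
    moreover have "((\<lambda>u. u * t) has_real_derivative t) (at u within {0..1})"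
      by (auto intro!: derivative_eq_intros)
    ultimately have "((snd c \<circ> \<gamma>) \<circ> (\<lambda>u. u * t) has_vector_derivative t *\<^sub>R F (\<gamma> (u * t)) c)
        (at u within {0..1})"
      unfolding has_real_derivative_iff_has_vector_derivative by (intro vector_diff_chain_within)
    then show ?thesis
      by (simp add: comp_def)
  qed
  ultimately show ?thesis
    unfolding scaled_curve_def by blast
qed

lemma scaled_curve_derivative:
  assumes "scaled_curve A F a \<eta>" "c \<in> A" "{s..t} \<subseteq> {0..1}" "u \<in> {s..t}" "\<eta> u \<in> fst c"
  shows "((\<lambda>u. snd c (\<eta> u)) has_vector_derivative a *\<^sub>R F (\<eta> u) c) (at u within {s..t})"
  using assms unfolding scaled_curve_def comp_def
  by (meson has_vector_derivative_within_subset subsetD)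

section \<open>Motion and deviation of curves in a single chart\<close>

lemma has_vector_derivative_norm_bound:
  fixes f :: "real \<Rightarrow> 'b::real_normed_vector"
  assumes der: "\<And>u. u \<in> {s..t} \<Longrightarrow> (f has_vector_derivative f' u) (at u within {s..t})"
    and B: "\<And>u. u \<in> {s..t} \<Longrightarrow> norm (f' u) \<le> B"
    and "x \<in> {s..t}" "y \<in> {s..t}"
  shows "norm (f x - f y) \<le> B * norm (x - y)"
proof (rule differentiable_bound[of "{s..t}" f "\<lambda>u h. h *\<^sub>R f' u"])
  fix u assume u: "u \<in> {s..t}"
  show "(f has_derivative (\<lambda>h. h *\<^sub>R f' u)) (at u within {s..t})"
    using der[OF u] by (simp add: has_vector_derivative_def)
  show "onorm (\<lambda>h. h *\<^sub>R f' u) \<le> B"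
    using B[OF u] by (intro onorm_le) (simp add: mult.commute[of B] mult_left_mono)
qed (use assms in auto)

text \<open>Until a first exit time \<open>m\<close> the coordinate speed is at most
  \<open>\<bar>a\<bar> * B\<close>, too little to cover the distance to radius
  \<open>r\<close>.\<close>

lemma scaled_curve_trapped:
  assumes \<eta>: "scaled_curve A F a \<eta>" and st: "{s..t} \<subseteq> {0..1}" "s \<le> t"
    and c: "c \<in> A" "is_chart c"
    and closed: "closed {x\<in>fst c. norm (snd c x - q) \<le> r}"
    and B: "\<And>x. x \<in> fst c \<Longrightarrow> norm (snd c x - q) \<le> r \<Longrightarrow> norm (F x c) \<le> B" and B0: "0 \<le> B"
    and start: "\<eta> s \<in> fst c" "norm (snd c (\<eta> s) - q) + \<bar>a\<bar> * B * (t - s) < r"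
    and u: "u \<in> {s..t}"
  shows "\<eta> u \<in> fst c \<and> norm (snd c (\<eta> u) - q) < r"
proof (rule ccontr)
  let ?Q = "{x\<in>fst c. norm (snd c x - q) < r}"
  let ?K = "{x\<in>fst c. norm (snd c x - q) \<le> r}"
  define S where "S = {u\<in>{s..t}. \<eta> u \<in> - ?Q}"
  assume "\<not> (\<eta> u \<in> fst c \<and> norm (snd c (\<eta> u) - q) < r)"
  then have "S \<noteq> {}"
    using u by (auto simp: S_def)
  have cont: "continuous_on {s..t} \<eta>"
    using \<eta> st unfolding scaled_curve_def by (meson continuous_on_subset)
  have "closed ({s..t} \<inter> \<eta> -` (- ?Q))"
    using cont chart_ball_open[OF c(2)] by (intro continuous_closed_preimage) auto
  moreover have "{s..t} \<inter> \<eta> -` (- ?Q) = S"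
    by (auto simp: S_def)
  ultimately have "closed S"
    by simp
  have bdd: "bdd_below S"
    by (auto simp: S_def bdd_below_def)
  \<comment> \<open>\<open>S\<close> is closed because the open coordinate ball is open in the
    manifold, so the infimum is itself an exit time.\<close>
  define m where "m = Inf S"
  have mS: "m \<in> S"
    using \<open>closed S\<close> bdd \<open>S \<noteq> {}\<close> unfolding m_def by (intro closed_contains_Inf)
  have before: "\<eta> v \<in> ?Q" if "v \<in> {s..<m}" for v
  proof (rule ccontr)
    assume "\<eta> v \<notin> ?Q"
    then have "v \<in> S"
      using that mS by (auto simp: S_def)
    then have "m \<le> v"
      unfolding m_def using bdd by (rule cInf_lower)
    with that show False by simp
  qed
  have "norm (snd c (\<eta> s) - q) < r"
  proof -
    have "0 \<le> \<bar>a\<bar> * B * (t - s)"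
      using B0 st(2) by simp
    then show ?thesis
      using start(2) by simp
  qed
  then have "s < m"
    using mS start(1) by (cases "s = m") (auto simp: S_def)
  \<comment> \<open>The closed ball is closed in the manifold, so the limit point
    \<open>\<eta> m\<close> is still in the chart domain and the speed bound holds up to
    \<open>m\<close> inclusive.\<close>
  have "\<eta> ` closure {s..<m} \<subseteq> ?K"
  proof (rule image_closure_subset)
    show "continuous_on (closure {s..<m}) \<eta>"
      using cont \<open>s < m\<close> mS by (auto simp: S_def intro: continuous_on_subset)
    show "\<eta> ` {s..<m} \<subseteq> ?K"
      using before by fastforce
  qed (use closed in auto)
  then have K: "\<eta> v \<in> ?K" if "v \<in> {s..m}" for v
    using that \<open>s < m\<close> by (auto simp: image_subset_iff)
  have "norm (snd c (\<eta> m) - snd c (\<eta> s)) \<le> \<bar>a\<bar> * B * norm (m - s)"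
  proof (rule has_vector_derivative_norm_bound[where f = "\<lambda>v. snd c (\<eta> v)"])
    show "((\<lambda>u. snd c (\<eta> u)) has_vector_derivative a *\<^sub>R F (\<eta> v) c) (at v within {s..m})"
      if "v \<in> {s..m}" for v
      using that K mS st by (intro scaled_curve_derivative[OF \<eta> c(1)]) (auto simp: S_def)
    show "norm (a *\<^sub>R F (\<eta> v) c) \<le> \<bar>a\<bar> * B" if "v \<in> {s..m}" for v
      using K[OF that] B by (auto intro!: mult_left_mono)
  qed (use \<open>s < m\<close> in auto)
  also have "\<dots> \<le> \<bar>a\<bar> * B * (t - s)"
    using \<open>s < m\<close> mS B0 by (auto simp: S_def intro!: mult_left_mono)
  finally have "norm (snd c (\<eta> m) - q) < r"
    using start(2) norm_triangle_ineq[of "snd c (\<eta> m) - snd c (\<eta> s)" "snd c (\<eta> s) - q"] by simp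
  moreover have "\<eta> m \<in> fst c"
    using K \<open>s < m\<close> by auto
  ultimately show False
    using mS by (simp add: S_def)
qed

text \<open>The interval is so short that the Lipschitz term is absorbed into the left-hand side, which
  replaces Gronwall's inequality.\<close>

lemma scaled_curve_deviation:
  assumes \<eta>: "scaled_curve A F a \<eta>" and \<eta>0: "scaled_curve A F a0 \<eta>0"
    and st: "{s..t} \<subseteq> {0..1}" "s \<le> t" and c: "c \<in> A" "is_chart c"
    and in_c: "\<And>u. u \<in> {s..t} \<Longrightarrow> \<eta> u \<in> fst c" "\<And>u. u \<in> {s..t} \<Longrightarrow> \<eta>0 u \<in> fst c"
    and lip: "\<And>u. u \<in> {s..t} \<Longrightarrow>
        norm (F (\<eta> u) c - F (\<eta>0 u) c) \<le> L * norm (snd c (\<eta> u) - snd c (\<eta>0 u))"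
    and B: "\<And>u. u \<in> {s..t} \<Longrightarrow> norm (F (\<eta>0 u) c) \<le> B"
    and short: "\<bar>a\<bar> * L * (t - s) \<le> 1/2" and "0 \<le> L"
  shows "norm (snd c (\<eta> t) - snd c (\<eta>0 t))
    \<le> 2 * norm (snd c (\<eta> s) - snd c (\<eta>0 s)) + 2 * (\<bar>a - a0\<bar> * B * (t - s))"
proof -
  let ?w = "\<lambda>u. snd c (\<eta> u) - snd c (\<eta>0 u)"
  have der: "(?w has_vector_derivative (a *\<^sub>R F (\<eta> u) c - a0 *\<^sub>R F (\<eta>0 u) c)) (at u within {s..t})"
    if "u \<in> {s..t}" for u
    using that in_c st
    by (intro has_vector_derivative_diff scaled_curve_derivative[OF \<eta> c(1)]
        scaled_curve_derivative[OF \<eta>0 c(1)])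
  have "continuous_on {s..t} ?w"
    using der has_vector_derivative_continuous continuous_on_eq_continuous_within by blast
  then have "continuous_on {s..t} (\<lambda>u. norm (?w u))"
    by (rule continuous_on_norm)
  \<comment> \<open>The deviation is estimated at its maximum over the interval, so that the
    Lipschitz term is a multiple of the very quantity being bounded.\<close>
  then obtain m where m: "m \<in> {s..t}" "\<And>u. u \<in> {s..t} \<Longrightarrow> norm (?w u) \<le> norm (?w m)"
    using continuous_attains_sup[of "{s..t}" "\<lambda>u. norm (?w u)"] st(2) by auto
  let ?C = "\<bar>a\<bar> * L * norm (?w m) + \<bar>a - a0\<bar> * B"
  have bd: "norm (a *\<^sub>R F (\<eta> u) c - a0 *\<^sub>R F (\<eta>0 u) c) \<le> ?C" if u: "u \<in> {s..t}" for u
  proof -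
    \<comment> \<open>Splitting off the change of speed at \<open>\<eta>0\<close> leaves one
      Lipschitz term with factor \<open>a\<close>, and requires the bound \<open>B\<close> along
      \<open>\<eta>0\<close> only.\<close>
    have "a *\<^sub>R F (\<eta> u) c - a0 *\<^sub>R F (\<eta>0 u) c
        = a *\<^sub>R (F (\<eta> u) c - F (\<eta>0 u) c) + (a - a0) *\<^sub>R F (\<eta>0 u) c"
      by (simp add: algebra_simps)
    also have "norm \<dots> \<le> \<bar>a\<bar> * norm (F (\<eta> u) c - F (\<eta>0 u) c) + \<bar>a - a0\<bar> * norm (F (\<eta>0 u) c)"
      by (metis norm_scaleR norm_triangle_ineq)
    also have "\<dots> \<le> \<bar>a\<bar> * (L * norm (?w m)) + \<bar>a - a0\<bar> * B"
    proof (intro add_mono mult_left_mono B[OF u])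
      show "norm (F (\<eta> u) c - F (\<eta>0 u) c) \<le> L * norm (?w m)"
        using lip[OF u] m(2)[OF u] \<open>0 \<le> L\<close> by (meson mult_left_mono order_trans)
    qed auto
    finally show ?thesis by simp
  qed
  have "0 \<le> B"
    using B[of s] st(2) norm_ge_zero order_trans by (metis atLeastAtMost_iff order_refl)
  then have "0 \<le> ?C"
    using \<open>0 \<le> L\<close> by simp
  have "norm (?w m - ?w s) \<le> ?C * norm (m - s)"
    by (rule has_vector_derivative_norm_bound[OF der bd]) (use m st(2) in auto)
  also have "\<dots> \<le> ?C * (t - s)"
    using m(1) \<open>0 \<le> ?C\<close> by (intro mult_left_mono) auto
  also have "\<dots> = (\<bar>a\<bar> * L * (t - s)) * norm (?w m) + \<bar>a - a0\<bar> * B * (t - s)"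
    by (simp add: algebra_simps)
  also have "\<dots> \<le> 1/2 * norm (?w m) + \<bar>a - a0\<bar> * B * (t - s)"
    using short by (intro add_right_mono mult_right_mono) auto
  finally have "norm (?w m) \<le> 2 * norm (?w s) + 2 * (\<bar>a - a0\<bar> * B * (t - s))"
    using norm_triangle_ineq[of "?w m - ?w s" "?w s"] by simp
  then show ?thesis
    using m(2)[of t] st(2) by simp
qed

section \<open>Continuous dependence and uniqueness for a smooth vector field\<close>

context
  fixes A :: "('a::{t2_space, second_countable_topology}, 'e::euclidean_space) chart set"
    and F :: "('a, 'e) vfield"
  assumes A: "smooth_manifold A" and F: "smooth_vector_field A F"
begin

text \<open>Closedness, inclusion in \<open>W\<close> and the Lipschitz bound each hold for all
  small radii, so one coordinate ball around \<open>p\<close> has them all.\<close>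

lemma lipschitz_chart_ball:
  assumes W: "open W" "p \<in> W"
  obtains c r L B where "c \<in> A" "is_chart c" "p \<in> fst c" "0 < r" "0 < L" "0 < B"
    "closed {x\<in>fst c. norm (snd c x - snd c p) \<le> r}"
    "\<And>x. x \<in> fst c \<Longrightarrow> norm (snd c x - snd c p) < r \<Longrightarrow> x \<in> W"
    "\<And>x. x \<in> fst c \<Longrightarrow> norm (snd c x - snd c p) \<le> r \<Longrightarrow> norm (F x c) \<le> B"
    "\<And>x y. x \<in> fst c \<Longrightarrow> norm (snd c x - snd c p) \<le> r \<Longrightarrow>
       y \<in> fst c \<Longrightarrow> norm (snd c y - snd c p) \<le> r \<Longrightarrow>
       norm (F x c - F y c) \<le> L * norm (snd c x - snd c y)"
proof -
  obtain c where c: "c \<in> A" "is_chart c" "p \<in> fst c"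
    using smooth_manifold_chart_at[OF A] by blast
  let ?q = "snd c p"
  obtain r1 where r1: "r1 > 0" "\<And>r. r \<le> r1 \<Longrightarrow> closed {x\<in>fst c. norm (snd c x - ?q) \<le> r}"
    using chart_cball_closed[OF c(2,3)] by blast
  obtain r2 where r2: "r2 > 0" "\<And>x. x \<in> fst c \<Longrightarrow> norm (snd c x - ?q) < r2 \<Longrightarrow> x \<in> W"
    using chart_nbhd_inside[OF c(2,3) W] by blast
  have "smooth_on (snd c ` fst c) (\<lambda>y. F (chart_inv c y) c)"
    using F c(1) unfolding smooth_vector_field_def by blast
  from smooth_on_locally_lipschitz[OF this, of ?q] obtain r3 L where r3: "r3 > 0"
    and L: "\<And>x y. x \<in> snd c ` fst c \<inter> cball ?q r3 \<Longrightarrow> y \<in> snd c ` fst c \<inter> cball ?q r3 \<Longrightarrow>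
      norm (F (chart_inv c x) c - F (chart_inv c y) c) \<le> L * norm (x - y)"
    using c(3) by blast
  define r where "r = min r1 (min r2 r3)"
  \<comment> \<open>Taking at least 1 makes the constant positive; it later stands in a
    denominator.\<close>
  define L' where "L' = max L 1"
  define B where "B = norm (F p c) + L' * r + 1"
  have r: "r > 0" "r \<le> r1" "r \<le> r2" "r \<le> r3"
    using r1 r2 r3 by (auto simp: r_def)
  have "0 < L'" by (simp add: L'_def)
  have lip: "norm (F x c - F y c) \<le> L' * norm (snd c x - snd c y)"
    if "x \<in> fst c" "norm (snd c x - ?q) \<le> r" "y \<in> fst c" "norm (snd c y - ?q) \<le> r" for x y
  proof -
    have "norm (F x c - F y c) \<le> L * norm (snd c x - snd c y)"
      using L[of "snd c x" "snd c y"] that r(4) chart_inv_snd[OF c(2)]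
      by (auto simp: dist_norm norm_minus_commute)
    also have "\<dots> \<le> L' * norm (snd c x - snd c y)"
      by (intro mult_right_mono) (auto simp: L'_def)
    finally show ?thesis .
  qed
  have "norm (F x c) \<le> B" if x: "x \<in> fst c" "norm (snd c x - ?q) \<le> r" for x
  proof -
    have "norm (F x c - F p c) \<le> L' * norm (snd c x - ?q)"
      using lip[OF x c(3)] r(1) by simp
    also have "\<dots> \<le> L' * r"
      using x \<open>0 < L'\<close> by (intro mult_left_mono) auto
    finally show ?thesis
      using norm_triangle_ineq[of "F x c - F p c" "F p c"] by (simp add: B_def)
  qed
  moreover have "0 < B"
    using r(1) \<open>0 < L'\<close> unfolding B_def
    by (smt (verit) mult_nonneg_nonneg norm_ge_zero)
  ultimately show thesis
    using that[OF c r(1) \<open>0 < L'\<close>] r1(2)[OF r(2)] r2(2) r(3) lip by force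
qed

text \<open>Near \<open>x\<close> one coordinate ball suffices: \<open>scaled_curve_trapped\<close>
  keeps \<open>\<eta>\<close> in it and \<open>scaled_curve_deviation\<close> compares it with
  \<open>\<eta>0\<close>. The length \<open>d\<close> is chosen before \<open>s\<close>,
  \<open>t\<close> and \<open>N\<close>, as the bisection principle \<open>Bolzano\<close>
  demands.\<close>

lemma scaled_curve_dependence_local:
  assumes \<eta>0: "scaled_curve A F a0 \<eta>0" and x: "x \<in> {0..1}" and W: "open W" "\<eta>0 x \<in> W"
  shows "\<exists>d>0. \<forall>s t. 0 \<le> s \<and> s \<le> x \<and> x \<le> t \<and> t \<le> 1 \<and> t - s < d \<longrightarrow>
    (\<forall>N. open N \<and> \<eta>0 t \<in> N \<longrightarrow> (\<exists>Q \<epsilon>. open Q \<and> \<eta>0 s \<in> Q \<and> 0 < \<epsilon> \<and>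
      (\<forall>a \<eta>. scaled_curve A F a \<eta> \<and> \<bar>a - a0\<bar> < \<epsilon> \<and> \<eta> s \<in> Q \<longrightarrow>
         \<eta> t \<in> N \<and> \<eta> ` {s..t} \<subseteq> W)))"
proof -
  obtain c r L B where c: "c \<in> A" "is_chart c" "\<eta>0 x \<in> fst c"
    and pos: "0 < r" "0 < L" "0 < B"
    and closed: "closed {y\<in>fst c. norm (snd c y - snd c (\<eta>0 x)) \<le> r}"
    and inW: "\<And>y. y \<in> fst c \<Longrightarrow> norm (snd c y - snd c (\<eta>0 x)) < r \<Longrightarrow> y \<in> W"
    and B: "\<And>y. y \<in> fst c \<Longrightarrow> norm (snd c y - snd c (\<eta>0 x)) \<le> r \<Longrightarrow> norm (F y c) \<le> B"
    and lip: "\<And>y y'. y \<in> fst c \<Longrightarrow> norm (snd c y - snd c (\<eta>0 x)) \<le> r \<Longrightarrow>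
       y' \<in> fst c \<Longrightarrow> norm (snd c y' - snd c (\<eta>0 x)) \<le> r \<Longrightarrow>
       norm (F y c - F y' c) \<le> L * norm (snd c y - snd c y')"
    using lipschitz_chart_ball[OF W] by blast
  let ?q = "snd c (\<eta>0 x)"
  let ?Q = "{y\<in>fst c. norm (snd c y - ?q) < r/4}"
  have "continuous_on {0..1} \<eta>0"
    using \<eta>0 by (simp add: scaled_curve_def)
  then have "\<forall>\<^sub>F u in at x within {0..1}. \<eta>0 u \<in> ?Q"
    using x c(3) pos(1) chart_ball_open[OF c(2), of ?q "r/4"]
    by (intro topological_tendstoD) (auto simp: continuous_on_def)
  then obtain d0 where d0: "d0 > 0"
    "\<And>u. u \<in> {0..1} \<Longrightarrow> u \<noteq> x \<Longrightarrow> \<bar>u - x\<bar> < d0 \<Longrightarrow> \<eta>0 u \<in> ?Q"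
    unfolding eventually_at by (auto simp: dist_real_def)
  have near: "\<eta>0 u \<in> ?Q" if "u \<in> {0..1}" "\<bar>u - x\<bar> < d0" for u
    using d0(2)[OF that(1) _ that(2)] c(3) pos(1) by (cases "u = x") auto
  \<comment> \<open>\<open>M\<close> bounds \<open>\<bar>a\<bar>\<close> for every speed
    \<open>a\<close> within distance 1 of \<open>a0\<close>.\<close>
  define M where "M = \<bar>a0\<bar> + 1"
  have M: "0 < M" by (simp add: M_def)
  \<comment> \<open>The three terms keep \<open>\<eta>0\<close> in the ball of radius
    \<open>r/4\<close>, let a curve travel less than \<open>r/2\<close>, and make the Lipschitz term
    at most one half.\<close>
  define d where "d = min d0 (min (r / (2 * M * B)) (1 / (2 * M * L)))"
  have d: "d > 0" "d \<le> d0" "d \<le> r / (2 * M * B)" "d \<le> 1 / (2 * M * L)"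
    using d0 pos M by (auto simp: d_def)
  have "\<exists>Q \<epsilon>. open Q \<and> \<eta>0 s \<in> Q \<and> 0 < \<epsilon> \<and>
      (\<forall>a \<eta>. scaled_curve A F a \<eta> \<and> \<bar>a - a0\<bar> < \<epsilon> \<and> \<eta> s \<in> Q \<longrightarrow> \<eta> t \<in> N \<and> \<eta> ` {s..t} \<subseteq> W)"
    if st: "0 \<le> s" "s \<le> x" "x \<le> t" "t \<le> 1" "t - s < d" and N: "open N" "\<eta>0 t \<in> N" for s t N
  proof -
    have near0: "\<eta>0 u \<in> ?Q" if "u \<in> {s..t}" for u
      using that st d(2) by (intro near) auto
    have sub: "{s..t} \<subseteq> {0..1}" "s \<le> t"
      using st by auto
    have short_bound: "M * B * (t - s) < r/2"
    proof -
      have "M * B * (t - s) < M * B * d"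
        using st M pos by simp
      also have "\<dots> \<le> r/2"
        using d(3) M pos by (simp add: field_simps)
      finally show ?thesis .
    qed
    have short_lip: "M * L * (t - s) \<le> 1/2"
    proof -
      have "M * L * (t - s) \<le> M * L * d"
        using st M pos by simp
      also have "\<dots> \<le> 1/2"
        using d(4) M pos by (simp add: field_simps)
      finally show ?thesis .
    qed
    obtain \<rho>' where \<rho>': "\<rho>' > 0" "\<And>y. y \<in> fst c \<Longrightarrow> norm (snd c y - snd c (\<eta>0 t)) < \<rho>' \<Longrightarrow> y \<in> N"
      using chart_nbhd_inside[OF c(2) _ N] near0[of t] sub by auto
    \<comment> \<open>The start is within \<open>r/4 + \<rho>\<close> of the centre, which leaves
      \<open>r/2\<close> for the motion. The final deviation is below
      \<open>2 * \<rho> + 2 * (\<rho>'/4)\<close>, hence below \<open>\<rho>'\<close>.\<close>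
    define \<rho> where "\<rho> = min (\<rho>'/4) (r/4)"
    define \<epsilon> where "\<epsilon> = min 1 (\<rho>' / (4 * B))"
    have \<rho>: "\<rho> > 0" "\<rho> \<le> \<rho>'/4" "\<rho> \<le> r/4" and \<epsilon>: "\<epsilon> > 0" "\<epsilon> \<le> 1" "\<epsilon> * B \<le> \<rho>'/4"
      using \<rho>' pos by (auto simp: \<rho>_def \<epsilon>_def min_def field_simps)
    let ?Q' = "{y\<in>fst c. norm (snd c y - snd c (\<eta>0 s)) < \<rho>}"
    have "\<eta> t \<in> N \<and> \<eta> ` {s..t} \<subseteq> W"
      if \<eta>: "scaled_curve A F a \<eta>" "\<bar>a - a0\<bar> < \<epsilon>" "\<eta> s \<in> ?Q'" for a \<eta>
    proof -
      have a: "\<bar>a\<bar> \<le> M"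
        using \<eta>(2) \<epsilon>(2) by (auto simp: M_def)
      have "norm (snd c (\<eta> s) - ?q) < r/2"
        using \<eta>(3) \<rho>(3) near0[of s] sub(2)
          norm_triangle_ineq[of "snd c (\<eta> s) - snd c (\<eta>0 s)" "snd c (\<eta>0 s) - ?q"] by auto
      moreover have "\<bar>a\<bar> * B * (t - s) \<le> M * B * (t - s)"
        using a pos sub(2) by (intro mult_right_mono) auto
      ultimately have "norm (snd c (\<eta> s) - ?q) + \<bar>a\<bar> * B * (t - s) < r"
        using short_bound by simp
      then have trap: "\<eta> u \<in> fst c \<and> norm (snd c (\<eta> u) - ?q) < r" if "u \<in> {s..t}" for u
        using \<eta>(3) that by (intro scaled_curve_trapped[OF \<eta>(1) sub c(1,2) closed B]) (use pos in auto)
      have "\<bar>a\<bar> * L * (t - s) \<le> M * L * (t - s)"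
        using a pos sub(2) by (intro mult_right_mono) auto
      then have short: "\<bar>a\<bar> * L * (t - s) \<le> 1/2"
        using short_lip by simp
      have "norm (snd c (\<eta> t) - snd c (\<eta>0 t))
          \<le> 2 * norm (snd c (\<eta> s) - snd c (\<eta>0 s)) + 2 * (\<bar>a - a0\<bar> * B * (t - s))"
      proof (rule scaled_curve_deviation[OF \<eta>(1) \<eta>0 sub c(1,2) _ _ _ _ short])
        fix u assume u: "u \<in> {s..t}"
        show "norm (F (\<eta> u) c - F (\<eta>0 u) c) \<le> L * norm (snd c (\<eta> u) - snd c (\<eta>0 u))"
          using trap[OF u] near0[OF u] pos(1) by (intro lip) auto
        show "norm (F (\<eta>0 u) c) \<le> B"
          using near0[OF u] pos(1) by (intro B) auto
      qed (use trap near0 pos in auto)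
      also have "\<dots> < 2 * \<rho> + 2 * (\<rho>'/4)"
      proof -
        have "\<bar>a - a0\<bar> * B * (t - s) \<le> \<bar>a - a0\<bar> * B * 1"
          using pos st by (intro mult_left_mono) auto
        also have "\<dots> \<le> \<epsilon> * B"
          using \<eta>(2) pos by simp
        finally show ?thesis
          using \<eta>(3) \<epsilon>(3) by simp
      qed
      also have "\<dots> \<le> \<rho>'"
        using \<rho>(2) by simp
      finally show ?thesis
        using \<rho>'(2) trap inW sub(2) by auto
    qed
    moreover have "open ?Q'"
      by (rule chart_ball_open[OF c(2)])
    moreover have "\<eta>0 s \<in> ?Q'"
      using near0[of s] sub(2) \<rho>(1) by auto
    ultimately show ?thesis
      using \<epsilon>(1) by blast
  qed
  with d(1) show ?thesis by blast
qed

text \<open>Local dependence propagates along the compact interval by bisection, since the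
  neighbourhoods compose across adjacent intervals.\<close>

lemma scaled_curve_dependence:
  assumes \<eta>0: "scaled_curve A F a0 \<eta>0" and t: "t \<in> {0..1}"
    and W: "open W" "\<eta>0 ` {0..t} \<subseteq> W" and N: "open N" "\<eta>0 t \<in> N"
  shows "\<exists>Q \<epsilon>. open Q \<and> \<eta>0 0 \<in> Q \<and> 0 < \<epsilon> \<and>
    (\<forall>a \<eta>. scaled_curve A F a \<eta> \<and> \<bar>a - a0\<bar> < \<epsilon> \<and> \<eta> 0 \<in> Q \<longrightarrow> \<eta> t \<in> N \<and> \<eta> ` {0..t} \<subseteq> W)"
proof -
  \<comment> \<open>\<open>N\<close> is quantified inside \<open>P\<close>, so that a new target can
    be prescribed at the middle time. The guard makes \<open>P\<close> vacuous for intervals that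
    stick out of \<open>[0,1]\<close>, over which the local hypothesis of \<open>Bolzano\<close>
    also ranges.\<close>
  define P where "P s t \<longleftrightarrow> 0 \<le> s \<and> t \<le> 1 \<longrightarrow>
    (\<forall>N. open N \<and> \<eta>0 t \<in> N \<longrightarrow> (\<exists>Q \<epsilon>. open Q \<and> \<eta>0 s \<in> Q \<and> 0 < \<epsilon> \<and>
      (\<forall>a \<eta>. scaled_curve A F a \<eta> \<and> \<bar>a - a0\<bar> < \<epsilon> \<and> \<eta> s \<in> Q \<longrightarrow>
         \<eta> t \<in> N \<and> \<eta> ` {s..t} \<subseteq> W)))" for s t
  have "P 0 t"
  proof (rule Bolzano)
    show "0 \<le> t" using t by simp
  next
    fix u v w assume P: "P u v" "P v w" and le: "u \<le> v" "v \<le> w"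
    show "P u w"
      unfolding P_def
    proof (intro impI allI)
      fix N assume uw: "0 \<le> u \<and> w \<le> 1" and N: "open N \<and> \<eta>0 w \<in> N"
      \<comment> \<open>The later interval comes first: the neighbourhood \<open>O1\<close> that it
        yields at time \<open>v\<close> is the target for the earlier one.\<close>
      then obtain O1 \<epsilon>1 where 1: "open O1" "\<eta>0 v \<in> O1" "0 < \<epsilon>1"
        "\<And>a \<eta>. scaled_curve A F a \<eta> \<Longrightarrow> \<bar>a - a0\<bar> < \<epsilon>1 \<Longrightarrow> \<eta> v \<in> O1 \<Longrightarrow> \<eta> w \<in> N \<and> \<eta> ` {v..w} \<subseteq> W"
        using P(2) le unfolding P_def by (meson order_trans)
      with P(1) uw le obtain O2 \<epsilon>2 where 2: "open O2" "\<eta>0 u \<in> O2" "0 < \<epsilon>2"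
        "\<And>a \<eta>. scaled_curve A F a \<eta> \<Longrightarrow> \<bar>a - a0\<bar> < \<epsilon>2 \<Longrightarrow> \<eta> u \<in> O2 \<Longrightarrow> \<eta> v \<in> O1 \<and> \<eta> ` {u..v} \<subseteq> W"
        unfolding P_def by (meson order_trans)
      have "{u..w} = {u..v} \<union> {v..w}"
        using le by auto
      then have "\<eta> w \<in> N \<and> \<eta> ` {u..w} \<subseteq> W"
        if "scaled_curve A F a \<eta>" "\<bar>a - a0\<bar> < min \<epsilon>1 \<epsilon>2" "\<eta> u \<in> O2" for a \<eta>
        using 1(4)[of a \<eta>] 2(4)[of a \<eta>] that by (simp add: image_Un)
      then show "\<exists>Q \<epsilon>. open Q \<and> \<eta>0 u \<in> Q \<and> 0 < \<epsilon> \<and>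
          (\<forall>a \<eta>. scaled_curve A F a \<eta> \<and> \<bar>a - a0\<bar> < \<epsilon> \<and> \<eta> u \<in> Q \<longrightarrow> \<eta> w \<in> N \<and> \<eta> ` {u..w} \<subseteq> W)"
        using 1(3) 2 by (intro exI[of _ O2] exI[of _ "min \<epsilon>1 \<epsilon>2"]) auto
    qed
  next
    fix x assume x: "0 \<le> x" "x \<le> t"
    with t W(2) have "x \<in> {0..1}" "\<eta>0 x \<in> W"
      by auto
    from scaled_curve_dependence_local[OF \<eta>0 this(1) W(1) this(2)]
    show "\<exists>d>0. \<forall>a b. a \<le> x \<and> x \<le> b \<and> b - a < d \<longrightarrow> P a b"
      unfolding P_def by (elim ex_forward conj_forward all_forward) simp_all
  qed
  then show ?thesis
    using N t unfolding P_def by simp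
qed

text \<open>Continuous dependence, with equal speeds and starting points, puts
  \<open>\<eta>' t\<close> into every neighbourhood of \<open>\<eta> t\<close>, and the manifold is
  Hausdorff.\<close>

lemma scaled_curve_unique:
  assumes "scaled_curve A F a \<eta>" "scaled_curve A F a \<eta>'" "\<eta> 0 = \<eta>' 0" "t \<in> {0..1}"
  shows "\<eta> t = \<eta>' t"
proof (rule ccontr)
  assume "\<eta> t \<noteq> \<eta>' t"
  then obtain N N' where N: "open N" "\<eta> t \<in> N" "\<eta>' t \<in> N'" "N \<inter> N' = {}"
    using hausdorff by metis
  obtain Q \<epsilon> where "\<eta> 0 \<in> Q" "0 < \<epsilon>"
    "\<And>a' \<eta>'. scaled_curve A F a' \<eta>' \<Longrightarrow> \<bar>a' - a\<bar> < \<epsilon> \<Longrightarrow> \<eta>' 0 \<in> Q \<Longrightarrow> \<eta>' t \<in> N"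
    using scaled_curve_dependence[OF assms(1,4) open_UNIV subset_UNIV N(1,2)] by metis
  then have "\<eta>' t \<in> N"
    using assms(2,3) by simp
  with N show False by auto
qed

section \<open>The flow\<close>

text \<open>Uniqueness makes the definite description in \<open>flow\<close> well defined, so any
  integral curve from \<open>x\<close> computes it.\<close>

lemma flow_eqI:
  assumes \<gamma>: "integral_curve A F S J \<gamma>" and J: "0 \<in> J" "t \<in> J" and "\<gamma> 0 = x"
  shows "flow A F S x t = \<gamma> t"
  unfolding flow_def
proof (rule the_equality)
  show "\<exists>J \<gamma>'. integral_curve A F S J \<gamma>' \<and> 0 \<in> J \<and> t \<in> J \<and> \<gamma>' 0 = x \<and> \<gamma>' t = \<gamma> t"
    using assms by blast
next
  fix y assume "\<exists>J \<gamma>. integral_curve A F S J \<gamma> \<and> 0 \<in> J \<and> t \<in> J \<and> \<gamma> 0 = x \<and> \<gamma> t = y"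
  then obtain J' \<gamma>' where \<gamma>': "integral_curve A F S J' \<gamma>'" "0 \<in> J'" "t \<in> J'" "\<gamma>' 0 = x" "\<gamma>' t = y"
    by blast
  have "\<gamma>' (1 * t) = \<gamma> (1 * t)"
    by (rule scaled_curve_unique[OF integral_curve_imp_scaled_curve[OF \<gamma>'(1-3)]
          integral_curve_imp_scaled_curve[OF \<gamma> J]])
      (use \<gamma>'(4) assms(4) in auto)
  then show "y = \<gamma> t"
    using \<gamma>'(5) by simp
qed

lemma flow_dom_orbit:
  assumes "(x, t) \<in> flow_dom A F S"
  obtains J \<gamma> where "integral_curve A F S J \<gamma>" "\<gamma> 0 = x" "0 \<in> J"
    "\<And>u. u \<in> {0..1} \<Longrightarrow> u * t \<in> J \<and> (x, u * t) \<in> flow_dom A F S \<and> flow A F S x (u * t) = \<gamma> (u * t)"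
proof -
  obtain J \<gamma> where \<gamma>: "integral_curve A F S J \<gamma>" "0 \<in> J" "t \<in> J" "\<gamma> 0 = x"
    using assms unfolding flow_dom_def by blast
  have "u * t \<in> J" if "u \<in> {0..1}" for u
    using integral_curve_scaled_time[OF \<gamma>(1-3) that] .
  moreover from this have "(x, u * t) \<in> flow_dom A F S" if "u \<in> {0..1}" for u
    using that \<gamma> unfolding flow_dom_def by blast
  ultimately show thesis
    using that[OF \<gamma>(1,4,2)] flow_eqI[OF \<gamma>(1,2) _ \<gamma>(4)] by blast
qed

lemma flow_0:
  assumes "(x, t) \<in> flow_dom A F S"
  shows "flow A F S x 0 = x"
  using flow_dom_orbit[OF assms] flow_eqI by metis

lemma flow_scaled_curve:
  assumes "(x, t) \<in> flow_dom A F S"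
  shows "scaled_curve A F t (\<lambda>u. flow A F S x (u * t))"
proof -
  obtain J \<gamma> where \<gamma>: "integral_curve A F S J \<gamma>" "0 \<in> J" "t \<in> J" "\<gamma> 0 = x"
    using assms unfolding flow_dom_def by blast
  then have sc: "scaled_curve A F t (\<lambda>u. \<gamma> (u * t))"
    using integral_curve_imp_scaled_curve by blast
  have eq: "flow A F S x (u * t) = \<gamma> (u * t)" if "u \<in> {0..1}" for u
    using integral_curve_scaled_time[OF \<gamma>(1-3) that] by (intro flow_eqI[OF \<gamma>(1,2) _ \<gamma>(4)])
  show ?thesis
    unfolding scaled_curve_def
  proof (intro conjI ballI impI)
    show "continuous_on {0..1} (\<lambda>u. flow A F S x (u * t))"
    proof (rule continuous_on_eq)
      show "continuous_on {0..1} (\<lambda>u. \<gamma> (u * t))"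
        using sc by (simp add: scaled_curve_def)
    qed (simp add: eq)
  next
    fix u c assume u: "u \<in> {0..1::real}" and c: "c \<in> A" "flow A F S x (u * t) \<in> fst c"
    then have "(snd c \<circ> (\<lambda>u. \<gamma> (u * t)) has_vector_derivative t *\<^sub>R F (\<gamma> (u * t)) c) (at u within {0..1})"
      using sc eq unfolding scaled_curve_def by auto
    then have "(snd c \<circ> (\<lambda>u. flow A F S x (u * t)) has_vector_derivative t *\<^sub>R F (\<gamma> (u * t)) c)
        (at u within {0..1})"
      \<comment> \<open>The two curves agree on \<open>[0,1]\<close>, which suffices for derivatives
        within that interval.\<close>
      by (rule has_vector_derivative_transform[rotated 2]) (use u eq in auto)
    then show "(snd c \<circ> (\<lambda>u. flow A F S x (u * t)) has_vector_derivative
        t *\<^sub>R F (flow A F S x (u * t)) c) (at u within {0..1})"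
      using eq[OF u] by simp
  qed
qed

section \<open>The flow of the restricted field, and fixed points\<close>

lemma flow_dom_restrict_imp:
  assumes "(x, t) \<in> flow_dom A F W"
  shows "(x, t) \<in> flow_dom A F UNIV" "flow A F UNIV x t \<in> W"
proof -
  obtain J \<gamma> where \<gamma>: "integral_curve A F W J \<gamma>" "0 \<in> J" "t \<in> J" "\<gamma> 0 = x"
    using assms unfolding flow_dom_def by blast
  then have \<gamma>': "integral_curve A F UNIV J \<gamma>"
    unfolding integral_curve_def by auto
  then show "(x, t) \<in> flow_dom A F UNIV"
    using \<gamma> unfolding flow_dom_def by blast
  show "flow A F UNIV x t \<in> W"
    using flow_eqI[OF \<gamma>' \<gamma>(2-4)] \<gamma> unfolding integral_curve_def by auto
qed

text \<open>An integral curve of the restriction needs an open time interval inside the preimage of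
  \<open>W\<close>. The component of 0 in that preimage is one, and it contains the segment from 0
  to \<open>t\<close>.\<close>

lemma flow_dom_restrictI:
  assumes W: "open W" and dom: "(x, t) \<in> flow_dom A F UNIV"
    and orbit: "\<And>u. u \<in> {0..1} \<Longrightarrow> flow A F UNIV x (u * t) \<in> W"
  shows "(x, t) \<in> flow_dom A F W"
proof -
  obtain J \<gamma> where \<gamma>: "integral_curve A F UNIV J \<gamma>" "\<gamma> 0 = x" "0 \<in> J"
    and J: "\<And>u. u \<in> {0..1} \<Longrightarrow> u * t \<in> J \<and> flow A F UNIV x (u * t) = \<gamma> (u * t)"
    using flow_dom_orbit[OF dom] by metis
  define J' where "J' = connected_component_set (J \<inter> \<gamma> -` W) 0"
  have "open (J \<inter> \<gamma> -` W)"
    using \<gamma> W unfolding integral_curve_def by (auto intro: continuous_open_preimage)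
  then have "open J'"
    unfolding J'_def by (rule open_connected_component)
  have sub: "J' \<subseteq> J \<inter> \<gamma> -` W"
    unfolding J'_def by (rule connected_component_subset)
  \<comment> \<open>\<open>closed_segment\<close> covers both signs of \<open>t\<close>.\<close>
  have "closed_segment 0 t \<subseteq> J \<inter> \<gamma> -` W"
    using J orbit by (fastforce simp: closed_segment_def)
  then have seg: "closed_segment 0 t \<subseteq> J'"
    unfolding J'_def by (intro connected_component_maximal) auto
  have "is_interval J'"
    unfolding J'_def by (simp add: is_interval_connected_1)
  then have "integral_curve A F W J' \<gamma>"
    using \<gamma>(1) \<open>open J'\<close> sub unfolding integral_curve_def
    by (auto intro: continuous_on_subset)
  then show ?thesis
    using seg \<gamma>(2) unfolding flow_dom_def by force
qed

text \<open>At a zero of the field the constant curve is an integral curve. This supplies the point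
  at which the connectedness argument starts.\<close>

lemma flow_fixed_point:
  assumes "vanishes_at A F z"
  shows "flow A F UNIV z t = z"
proof (rule flow_eqI[of UNIV UNIV "\<lambda>_. z"])
  show "integral_curve A F UNIV UNIV (\<lambda>_. z)"
    using assms unfolding integral_curve_def vanishes_at_def
    by (auto simp: comp_def)
qed auto

end

section \<open>Smooth functions on subsets of the manifold\<close>

text \<open>Near each point the extension \<open>g\<close> is a chart followed by a smooth function
  of the coordinates. Continuity lets nearby points have nearby shift times.\<close>

lemma C_inf_imp_continuous_on:
  assumes "smooth_manifold A'" and \<iota>: "continuous_on V \<iota>" and \<alpha>: "\<alpha> \<in> C_inf A' \<iota> V"
  shows "continuous_on V \<alpha>"
proof -
  obtain Q g where Q: "open Q" "\<iota> ` V \<subseteq> Q" "\<forall>x\<in>V. \<alpha> x = g (\<iota> x)"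
    and g: "\<And>c. c \<in> A' \<Longrightarrow> smooth_on (snd c ` (fst c \<inter> Q)) (g \<circ> chart_inv c)"
    using \<alpha> unfolding C_inf_def by blast
  have "isCont g y" if "y \<in> Q" for y
  proof -
    obtain c where c: "c \<in> A'" "is_chart c" "y \<in> fst c"
      using smooth_manifold_chart_at[OF assms(1)] by blast
    have "continuous_on (fst c \<inter> Q) (snd c)"
      using is_chart_continuous_on[OF c(2)] by (rule continuous_on_subset) auto
    then have "continuous_on (fst c \<inter> Q) ((g \<circ> chart_inv c) \<circ> snd c)"
      using smooth_on_imp_continuous_on[OF g[OF c(1)]] by (rule continuous_on_compose)
    then have "continuous_on (fst c \<inter> Q) g"
      by (rule continuous_on_eq) (simp add: chart_inv_snd[OF c(2)])
    then show ?thesis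
      using that c(3) Q(1) is_chart_open[OF c(2)]
      by (simp add: continuous_on_eq_continuous_at open_Int)
  qed
  then have "continuous_on Q g"
    using continuous_at_imp_continuous_on by blast
  then have "continuous_on V (g \<circ> \<iota>)"
    using \<iota> Q(2) by (intro continuous_on_compose) (auto intro: continuous_on_subset)
  then show ?thesis
    by (rule continuous_on_eq) (simp add: Q(3))
qed

section \<open>Shift maps\<close>

theorem lemma11p2:
  fixes A :: "('a::{t2_space, second_countable_topology}, 'e::euclidean_space) chart set"
    and A' :: "('b::{t2_space, second_countable_topology}, 'e) chart set"
    and \<iota> :: "'a \<Rightarrow> 'b" and \<kappa> :: "'a \<times> real \<Rightarrow> 'b"
    and F :: "('a, 'e) vfield" and W V :: "'a set" and z :: 'a
  assumes "smooth_manifold A"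
    and "collaring A A' \<iota> \<kappa>"
    and "smooth_vector_field A F"
    and "tangent_to_boundary A F"
    and "open W"
    and "z \<in> W"
    and "vanishes_at A F z"
    and "V \<subseteq> W"
    and "connected V"
    and "D_neighbourhood A A' \<iota> V z"
    and "proper_boundary_intersection A F W V"
  shows "func A F W A' \<iota> V = U_set A F W A' \<iota> V"
proof (intro equalityI subsetI)
  fix \<alpha> assume "\<alpha> \<in> func A F W A' \<iota> V"
  then show "\<alpha> \<in> U_set A F W A' \<iota> V"
    using flow_dom_restrict_imp[OF assms(1,3)]
    unfolding func_def U_set_def shift_map_def by blast
next
  fix \<alpha> assume \<alpha>: "\<alpha> \<in> U_set A F W A' \<iota> V"
  then have \<alpha>C: "\<alpha> \<in> C_inf A' \<iota> V" and dom: "\<And>x. x \<in> V \<Longrightarrow> (x, \<alpha> x) \<in> flow_dom A F UNIV"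
    and shift: "\<And>x. x \<in> V \<Longrightarrow> flow A F UNIV x (\<alpha> x) \<in> W"
    unfolding U_set_def func_def shift_map_def by auto
  have A': "smooth_manifold A'" and "continuous_on UNIV \<iota>"
    using assms(2) unfolding collaring_def smooth_embedding_def homeomorphism_def by auto
  then have cont: "continuous_on V \<alpha>"
    using C_inf_imp_continuous_on[OF A' _ \<alpha>C] continuous_on_subset by blast
  \<comment> \<open>Rescaling puts the end of every orbit at parameter 1, whatever the sign of
    \<open>\<alpha> x\<close>, and makes \<open>\<alpha> x\<close> the speed.\<close>
  define \<eta> where "\<eta> x u = flow A F UNIV x (u * \<alpha> x)" for x u
  have curve: "scaled_curve A F (\<alpha> x) (\<eta> x)" and start: "\<eta> x 0 = x" if "x \<in> V" for x
    unfolding \<eta>_def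
    using flow_scaled_curve[OF assms(1,3) dom[OF that]] flow_0[OF assms(1,3) dom[OF that]] by auto
  \<comment> \<open>Points \<open>y\<close> of \<open>V\<close> near \<open>x\<close> have a nearby
    speed \<open>\<alpha> y\<close> as well. Openness of \<open>V0\<close> takes \<open>N\<close> to
    be the whole space, openness of \<open>V - V0\<close> takes \<open>W'\<close> to be the whole
    space.\<close>
  have nbhd: "\<exists>T. openin (top_of_set V) T \<and> x \<in> T \<and> (\<forall>y\<in>T. \<eta> y t \<in> N \<and> \<eta> y ` {0..t} \<subseteq> W')"
    if x: "x \<in> V" "t \<in> {0..1}" "open W'" "\<eta> x ` {0..t} \<subseteq> W'" "open N" "\<eta> x t \<in> N" for x t W' N
  proof -
    obtain Q' \<epsilon> where Q': "open Q'" "x \<in> Q'" "0 < \<epsilon>"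
      "\<And>a \<eta>. scaled_curve A F a \<eta> \<Longrightarrow> \<bar>a - \<alpha> x\<bar> < \<epsilon> \<Longrightarrow> \<eta> 0 \<in> Q' \<Longrightarrow> \<eta> t \<in> N \<and> \<eta> ` {0..t} \<subseteq> W'"
      using scaled_curve_dependence[OF assms(1,3) curve[OF x(1)] x(2-6)] start[OF x(1)] by metis
    have "openin (top_of_set V) ((V \<inter> \<alpha> -` ball (\<alpha> x) \<epsilon>) \<inter> (V \<inter> Q'))"
      using cont Q'(1) by (intro openin_Int continuous_openin_preimage_gen openin_open_Int) auto
    moreover have "\<eta> y t \<in> N \<and> \<eta> y ` {0..t} \<subseteq> W'"
      if "y \<in> (V \<inter> \<alpha> -` ball (\<alpha> x) \<epsilon>) \<inter> (V \<inter> Q')" for y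
      using that Q'(4)[OF curve] start by (auto simp: dist_real_def abs_minus_commute)
    ultimately show ?thesis
      using x(1) Q'(2,3) by (intro exI[of _ "(V \<inter> \<alpha> -` ball (\<alpha> x) \<epsilon>) \<inter> (V \<inter> Q')"]) auto
  qed
  define V0 where "V0 = {x\<in>V. \<eta> x ` {0..1} \<subseteq> W}"
  have "openin (top_of_set V) V0"
    unfolding openin_subopen[of _ V0]
  proof
    fix x assume x: "x \<in> V0"
    then have "x \<in> V" "\<eta> x ` {0..1} \<subseteq> W"
      by (auto simp: V0_def)
    from nbhd[OF this(1) _ assms(5) this(2) open_UNIV]
    obtain T where "openin (top_of_set V) T" "x \<in> T" "\<forall>y\<in>T. \<eta> y ` {0..1} \<subseteq> W"
      by auto
    moreover from this have "T \<subseteq> V0"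
      using openin_imp_subset[of euclidean V T] by (auto simp: V0_def)
    ultimately show "\<exists>T. openin (top_of_set V) T \<and> x \<in> T \<and> T \<subseteq> V0"
      by blast
  qed
  moreover have "openin (top_of_set V) (V - V0)"
    unfolding openin_subopen[of _ "V - V0"]
  proof
    fix x assume x: "x \<in> V - V0"
    then have xV: "x \<in> V" by simp
    \<comment> \<open>Being outside \<open>closure W\<close> at a fixed time is an open condition
      and so passes to nearby orbits; being outside \<open>W\<close> is only a closed one.\<close>
    have "\<exists>t\<in>{0..1}. \<eta> x t \<notin> closure W"
    proof (rule ccontr)
      assume cl: "\<not> (\<exists>t\<in>{0..1}. \<eta> x t \<notin> closure W)"
      define S where "S = {0..1} \<inter> \<eta> x -` (- W)"
      have "continuous_on {0..1} (\<eta> x)"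
        using curve[OF xV] by (simp add: scaled_curve_def)
      then have "closed S"
        unfolding S_def using assms(5) by (intro continuous_closed_preimage) auto
      moreover have "S \<noteq> {}"
        using x by (auto simp: S_def V0_def)
      moreover have bdd: "bdd_below S"
        by (auto simp: S_def bdd_below_def)
      ultimately have mS: "Inf S \<in> S"
        by (intro closed_contains_Inf)
      \<comment> \<open>\<open>m\<close> is the first time outside \<open>W\<close>. It is neither
        0, as \<open>V\<close> lies in \<open>W\<close>, nor 1, as the shift ends in
        \<open>W\<close>.\<close>
      define m where "m = Inf S"
      have m: "m \<in> {0..1}" "\<eta> x m \<notin> W"
        using mS by (auto simp: S_def m_def)
      have "m \<noteq> 0"
        using m(2) start[OF xV] xV assms(8) by auto
      moreover have "m \<noteq> 1"
        using m(2) shift[OF xV] by (auto simp: \<eta>_def)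
      ultimately have m01: "0 < m" "m < 1"
        using m(1) by auto
      have before: "\<eta> x u \<in> W" if "u \<in> {0..<m}" for u
      proof (rule ccontr)
        assume "\<eta> x u \<notin> W"
        then have "u \<in> S"
          using that m(1) by (auto simp: S_def)
        then have "m \<le> u"
          unfolding m_def using bdd by (rule cInf_lower)
        with that show False by simp
      qed
      have dom': "(x, u * \<alpha> x) \<in> flow_dom A F UNIV" if "u \<in> {0..1}" for u
        using flow_dom_orbit[OF assms(1,3) dom[OF xV]] that by metis
      \<comment> \<open>The intersection property is applied with \<open>a = m * \<alpha> x\<close>
        and \<open>T = 1 / m\<close>: its time 1 is the exit time, and its time \<open>T\<close> is
        the end of the rescaled orbit.\<close>
      have "(x, \<tau> * (m * \<alpha> x)) \<in> flow_dom A F UNIV \<and> flow A F UNIV x (\<tau> * (m * \<alpha> x)) \<in> W"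
        if \<tau>: "\<tau> \<in> {0..<1} \<union> {1 / m}" for \<tau>
      proof (cases "\<tau> = 1 / m")
        case True
        then show ?thesis
          using m01 dom[OF xV] shift[OF xV] by simp
      next
        case False
        then have "0 \<le> \<tau>" "\<tau> < 1"
          using \<tau> by auto
        then have "\<tau> * m \<in> {0..<m}"
          using m01 by simp
        moreover have "{0..<m} \<subseteq> {0..1}"
          using m01 by auto
        ultimately show ?thesis
          using before[of "\<tau> * m"] dom'[of "\<tau> * m"]
          unfolding \<eta>_def mult.assoc by blast
      qed
      \<comment> \<open>The exit point is in \<open>closure W\<close> by the assumption
        \<open>cl\<close>, hence on the frontier.\<close>
      moreover have "(x, m * \<alpha> x) \<in> flow_dom A F UNIV" "flow A F UNIV x (m * \<alpha> x) \<in> closure W - W"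
        using dom' m cl by (auto simp: \<eta>_def)
      moreover have "1 < 1 / m"
        using m01 by simp
      ultimately have "\<exists>\<tau>'\<in>{1<..<1 / m}. flow A F UNIV x (\<tau>' * (m * \<alpha> x)) \<notin> closure W"
        using assms(11) xV unfolding proper_boundary_intersection_def by blast
      then obtain \<tau>' where \<tau>': "1 < \<tau>'" "\<tau>' < 1 / m" "flow A F UNIV x (\<tau>' * (m * \<alpha> x)) \<notin> closure W"
        by auto
      \<comment> \<open>The point outside \<open>closure W\<close> occurs before the end of the
        rescaled orbit, where \<open>cl\<close> excludes it.\<close>
      have "\<tau>' * m \<in> {0..1}"
        using \<tau>'(1,2) m01 by (auto simp: field_simps)
      then show False
        using cl \<tau>'(3) unfolding \<eta>_def mult.assoc[symmetric] by blast
    qed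
    then obtain t where t: "t \<in> {0..1}" "\<eta> x t \<in> - closure W"
      by auto
    from nbhd[OF xV t(1) open_UNIV _ _ t(2)]
    obtain T where T: "openin (top_of_set V) T" "x \<in> T" "\<forall>y\<in>T. \<eta> y t \<in> - closure W"
      by auto
    have "y \<notin> V0" if "y \<in> T" for y
    proof -
      have "\<eta> y t \<notin> W"
        using T(3) that closure_subset[of W] by blast
      then show ?thesis
        using t(1) unfolding V0_def by blast
    qed
    then have "T \<subseteq> V - V0"
      using openin_imp_subset[OF T(1)] by blast
    with T(1,2) show "\<exists>T. openin (top_of_set V) T \<and> x \<in> T \<and> T \<subseteq> V - V0"
      by blast
  qed
  then have "closedin (top_of_set V) V0"
    by (simp add: closedin_def V0_def)
  moreover have "z \<in> V0"
  proof -
    have "z \<in> V"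
      using assms(10) interior_subset unfolding D_neighbourhood_def by blast
    then show ?thesis
      using assms(6) flow_fixed_point[OF assms(1,3,7)] by (auto simp: V0_def \<eta>_def)
  qed
  ultimately have "V0 = V"
    using assms(9) unfolding connected_clopen by (metis empty_iff)
  have "(x, \<alpha> x) \<in> flow_dom A F W" if "x \<in> V" for x
  proof (rule flow_dom_restrictI[OF assms(1,3,5) dom[OF that]])
    have "\<eta> x ` {0..1} \<subseteq> W"
      using \<open>x \<in> V\<close> \<open>V0 = V\<close> unfolding V0_def by blast
    then show "flow A F UNIV x (u * \<alpha> x) \<in> W" if "u \<in> {0..1}" for u
      using that unfolding \<eta>_def by blast
  qed
  then show "\<alpha> \<in> func A F W A' \<iota> V"
    using \<alpha>C unfolding func_def by blast
qed

end
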